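(* Let $A$ be the generator of a bounded $C_0$-semigroup on a Banach space $X$, $\|e^{tA}\|\le N$ for all $t\ge0$, and let $\gamma>0$. For all $v\in X$ and all functions $f\in\mathcal{M}$, $$f(A)v\in\overline{\mathcal{K}_\infty((\gamma-A)^{-1},v)}.$$
   Context: Maximal resolvent Krylov subspace: $\mathcal{K}_\infty((\gamma-A)^{-1},v)=\mathrm{span}\{v,(\gamma-A)^{-1}v,(\gamma-A)^{-2}v,\ldots\}$ (all finite linear combinations); the bar denotes the closure in $X$. Functional calculus. The Fourier transform is $\mathcal{F}f(s)=\frac{1}{2\pi}\int_{-\infty}^\infty e^{-ixs}f(x)\,dx$ for $f\in L^1(\mathbb{R})$, and is understood in the sense of distributions for $f\notin L^1(\mathbb{R})$. Let $$\mathcal{M}_+=\{f\in C(\mathbb{R})\mid \mathcal{F}f\in L^1(\mathbb{R})\text{ and }\mathrm{supp}(\mathcal{F}f)\subseteq[0,\infty)\},$$ where $C(\mathbb{R})$ is the space of continuous functions $\mathbb{R}\to\mathbb{C}$. For $f$ holomorphic in the left half-plane, $f_{(0)}:\mathbb{R}\to\mathbb{C}$ is the restriction to $\mathrm{Re}\,z=0$, $f_{(0)}(\xi)=f(i\xi)$. Let $$\widetilde{\mathcal{M}}=\{f\text{ holomorphic and bounded for }\mathrm{Re}\,z\le 0\mid f_{(0)}\in\mathcal{M}_+\}.$$ For $f\in\widetilde{\mathcal{M}}$, define the bounded operator $f(A)=\int_0^\infty e^{sA}\,\mathcal{F}f_{(0)}(s)\,ds$. Let $$\mathcal{M}_0=\Bigl\{f\text{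 holomorphic for }\mathrm{Re}\,z\le 0\;\Big|\;\exists\,n\in\mathbb{N}_0:\ \frac{f(z)}{(1-z)^n}\in\widetilde{\mathcal{M}}\Bigr\}.$$ For $f\in\mathcal{M}_0$ set $f(A)=(1-A)^n\Bigl(\frac{f(z)}{(1-z)^n}\Bigr)(A)$, with $n$ such that $\frac{f(z)}{(1-z)^n}\in\widetilde{\mathcal{M}}$; this is independent of the choice of $n$ and is a closed operator on $X$ (with its natural domain). Finally, $$\mathcal{M}=\{f\in\mathcal{M}_0\mid f(A):X\to X\text{ is bounded}\}.$$ *)

theory Defs
  imports "HOL-Analysis.Analysis"
begin

section \<open>Complex Banach spaces and linear operators\<close>

class complex_banach = banach +
  fixes scaleC :: "complex \<Rightarrow> 'a \<Rightarrow> 'a"  (infixr "*\<^sub>C" 75)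
  assumes scaleC_add_right: "c *\<^sub>C (x + y) = c *\<^sub>C x + c *\<^sub>C y"
    and scaleC_add_left: "(c + d) *\<^sub>C x = c *\<^sub>C x + d *\<^sub>C x"
    and scaleC_scaleC: "c *\<^sub>C (d *\<^sub>C x) = (c * d) *\<^sub>C x"
    and scaleC_of_real: "complex_of_real r *\<^sub>C x = r *\<^sub>R x"
    and norm_scaleC: "norm (c *\<^sub>C x) = cmod c * norm x"

instantiation complex :: complex_banach
begin

definition scaleC_complex_def: "scaleC c (x :: complex) = c * x"

instance
  by standard (simp_all add: scaleC_complex_def algebra_simps scaleR_conv_of_real norm_mult)

end

interpretation complex_vector: vector_space "scaleC :: complex \<Rightarrow> 'a \<Rightarrow> 'a::complex_banach"
proof
  show "1 *\<^sub>C x = x" for x :: 'a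
    using scaleC_of_real[of 1 x] by simp
qed (simp_all add: scaleC_add_right scaleC_add_left scaleC_scaleC)

definition bounded_clinear :: "('a::complex_banach \<Rightarrow> 'a) \<Rightarrow> bool" where
  "bounded_clinear B \<longleftrightarrow> bounded_linear B \<and> (\<forall>c x. B (c *\<^sub>C x) = c *\<^sub>C B x)"

text \<open>
  Possibly unbounded operators are represented by their graphs, so that the domain is
  \<^term>\<open>Domain G\<close>, the inverse is the converse relation, a product is a relational
  composition and powers are \<^term>\<open>G ^^ n\<close>; all of them carry their natural domains.
\<close>

definition apply_op :: "('a \<times> 'a) set \<Rightarrow> 'a \<Rightarrow> 'a" where
  "apply_op G x = (THE y. (x, y) \<in> G)"

definition minus_op :: "real \<Rightarrow> ('a::real_vector \<times> 'a) set \<Rightarrow> ('a \<times> 'a) set" where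
  "minus_op c A = {(x, c *\<^sub>R x - y) | x y. (x, y) \<in> A}"

text \<open>The operator \<open>(\<gamma> - A)\<^sup>-\<^sup>1\<close>.\<close>

definition resolvent_op :: "real \<Rightarrow> ('a::real_vector \<times> 'a) set \<Rightarrow> ('a \<times> 'a) set" where
  "resolvent_op \<gamma> A = (minus_op \<gamma> A)\<inverse>"

definition krylov :: "('a::complex_banach \<times> 'a) set \<Rightarrow> 'a \<Rightarrow> 'a set" where
  "krylov R v = complex_vector.span {w. \<exists>k. (v, w) \<in> R ^^ k}"


section \<open>Strongly continuous semigroups\<close>

text \<open>Only the values \<open>T t\<close> for \<open>t \<ge> 0\<close> are relevant.\<close>

definition c0_semigroup :: "(real \<Rightarrow> 'a::complex_banach \<Rightarrow> 'a) \<Rightarrow> bool" where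
  "c0_semigroup T \<longleftrightarrow>
     (\<forall>t\<ge>0. bounded_clinear (T t)) \<and>
     (\<forall>x. T 0 x = x) \<and>
     (\<forall>s\<ge>0. \<forall>t\<ge>0. \<forall>x. T (s + t) x = T s (T t x)) \<and>
     (\<forall>x. ((\<lambda>t. T t x) \<longlongrightarrow> x) (at_right 0))"

definition generator :: "(real \<Rightarrow> 'a::complex_banach \<Rightarrow> 'a) \<Rightarrow> ('a \<times> 'a) set" where
  "generator T = {(x, y). ((\<lambda>h. (T h x - x) /\<^sub>R h) \<longlongrightarrow> y) (at_right 0)}"


section \<open>The Fourier transform\<close>

definition fourier :: "(real \<Rightarrow> complex) \<Rightarrow> real \<Rightarrow> complex" where
  "fourier f s = 1 / (2 * of_real pi) * (LINT x|lborel. exp (- (\<i> * of_real (x * s))) * f x)"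

text \<open>Schwartz functions; \<open>D k\<close> is the \<open>k\<close>-th derivative of \<open>\<phi>\<close>.\<close>

definition schwartz :: "(real \<Rightarrow> complex) set" where
  "schwartz = {\<phi>. \<exists>D :: nat \<Rightarrow> real \<Rightarrow> complex. D 0 = \<phi> \<and>
     (\<forall>k x. (D k has_vector_derivative D (Suc k) x) (at x)) \<and>
     (\<forall>k m. bounded (range (\<lambda>x. of_real (x ^ m) * D k x)))}"

text \<open>
  \<open>is_fourier f g\<close> says that the Fourier transform of \<open>f\<close> is the function \<open>g\<close>. For
  \<open>f \<notin> L\<^sup>1\<close> this is the identity \<open>\<langle>\<F>f, \<phi>\<rangle> = \<langle>f, \<F>\<phi>\<rangle>\<close> defining the Fourier transform of a
  tempered distribution. The first integrability condition makes \<open>f\<close> a regular tempered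
  distribution; it excludes no \<open>f\<close> whose Fourier transform is in \<open>L\<^sup>1\<close>, since such an \<open>f\<close>
  is essentially bounded.
\<close>

definition is_fourier :: "(real \<Rightarrow> complex) \<Rightarrow> (real \<Rightarrow> complex) \<Rightarrow> bool" where
  "is_fourier f g \<longleftrightarrow>
     (if integrable lborel f then (AE s in lborel. g s = fourier f s)
      else (\<forall>\<phi>\<in>schwartz.
              integrable lborel (\<lambda>x. f x * \<phi> x) \<and>
              integrable lborel (\<lambda>s. g s * \<phi> s) \<and>
              (LINT s|lborel. g s * \<phi> s) = (LINT x|lborel. f x * fourier \<phi> x)))"

text \<open>The support of a function as a distribution, insensitive to null sets.\<close>

definition ess_support :: "(real \<Rightarrow> complex) \<Rightarrow> real set" where
  "ess_support g = - \<Union>{U. open U \<and> (AE s in lborel. s \<in> U \<longrightarrow> g s = 0)}"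


section \<open>The functional calculus\<close>

definition M_plus :: "(real \<Rightarrow> complex) set" where
  "M_plus = {f. continuous_on UNIV f \<and>
     (\<exists>g. is_fourier f g \<and> integrable lborel g \<and> ess_support g \<subseteq> {0..})}"

definition imag_restrict :: "(complex \<Rightarrow> complex) \<Rightarrow> real \<Rightarrow> complex" where
  "imag_restrict f \<xi> = f (\<i> * of_real \<xi>)"

text \<open>
  A function on \<open>Re z \<le> 0\<close> is represented by a total function whose values elsewhere are
  irrelevant. At boundary points, \<^term>\<open>f holomorphic_on {z. Re z \<le> 0}\<close> means complex
  differentiability within the closed half-plane, which is implied by holomorphy on an open
  neighbourhood of it.
\<close>

definition M_tilde :: "(complex \<Rightarrow> complex) set" where
  "M_tilde = {f. f holomorphic_on {z. Re z \<le> 0} \<and> bounded (f ` {z. Re z \<le> 0}) \<and>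
     imag_restrict f \<in> M_plus}"

text \<open>
  \<open>f(A) = \<integral>\<^sub>0\<^sup>\<infinity> e\<^sup>s\<^sup>A \<F>f\<^sub>(\<^sub>0\<^sub>)(s) ds\<close>, taken pointwise. The library's Bochner integral is restricted to
  separable codomains, whence the Henstock-Kurzweil integral, which exists and has the
  same value for every Bochner integrable function. The transform \<open>g\<close> is unique almost everywhere,
  so the relation below is the graph of a function.
\<close>

definition calc_tilde ::
    "(real \<Rightarrow> 'a::complex_banach \<Rightarrow> 'a) \<Rightarrow> (complex \<Rightarrow> complex) \<Rightarrow> ('a \<times> 'a) set" where
  "calc_tilde T f = {(x, y). \<exists>g. is_fourier (imag_restrict f) g \<and> integrable lborel g \<and>
     ((\<lambda>s. g s *\<^sub>C T s x) has_integral y) {0..}}"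

definition M_zero :: "(complex \<Rightarrow> complex) set" where
  "M_zero = {f. f holomorphic_on {z. Re z \<le> 0} \<and> (\<exists>n. (\<lambda>z. f z / (1 - z) ^ n) \<in> M_tilde)}"

text \<open>
  \<open>f(A) = (1 - A)\<^sup>n (f(z)/(1 - z)\<^sup>n)(A)\<close> with its natural domain. All admissible \<open>n\<close> give the
  same graph, so that their union is the graph for any one of them.
\<close>

definition calc ::
    "(real \<Rightarrow> 'a::complex_banach \<Rightarrow> 'a) \<Rightarrow> (complex \<Rightarrow> complex) \<Rightarrow> ('a \<times> 'a) set" where
  "calc T f = (\<Union>n\<in>{n. (\<lambda>z. f z / (1 - z) ^ n) \<in> M_tilde}.
     calc_tilde T (\<lambda>z. f z / (1 - z) ^ n) O (minus_op 1 (generator T)) ^^ n)"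

definition M_calc :: "(real \<Rightarrow> 'a::complex_banach \<Rightarrow> 'a) \<Rightarrow> (complex \<Rightarrow> complex) set" where
  "M_calc T = {f \<in> M_zero. \<exists>B. bounded_clinear B \<and> calc T f = {(x, B x) | x. True}}"

end

theory Submission
  imports Defs
begin

text \<open>
  Let \<open>K\<close> be the closed Krylov subspace; it is invariant under \<open>(\<gamma> - A)\<^sup>-\<^sup>1\<close>. The resolvent equation
  and the contraction principle propagate invariance to \<open>(l - A)\<^sup>-\<^sup>1\<close> for all \<open>l \<ge> \<gamma>\<close>, and the
  implicit Euler scheme \<open>(1 - (t/n) A)\<^sup>-\<^sup>n x \<rightarrow> e\<^sup>t\<^sup>A x\<close> then to the semigroup. Hence \<open>K\<close> contains the
  integrals \<open>\<integral> g(s) e\<^sup>s\<^sup>A v ds\<close>, as limits of Riemann sums, and with \<open>x \<in> D(A)\<close> also \<open>A x\<close>, as a limit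
  of difference quotients. So \<open>f(A) v = (1 - A)\<^sup>n \<integral> g(s) e\<^sup>s\<^sup>A v ds\<close> lies in \<open>K\<close>.
\<close>

section \<open>Closed subspaces and integrals with values in them\<close>

lemma bounded_linear_scaleC: "bounded_linear (\<lambda>x::'a::complex_banach. c *\<^sub>C x)"
proof
  show "c *\<^sub>C (r *\<^sub>R x) = r *\<^sub>R (c *\<^sub>C x)" for r and x :: 'a
    by (metis mult.commute scaleC_of_real scaleC_scaleC)
  show "\<exists>K. \<forall>x::'a. norm (c *\<^sub>C x) \<le> norm x * K"
    by (rule exI[of _ "cmod c"]) (simp add: norm_scaleC mult.commute)
qed (simp add: scaleC_add_right)

lemma complex_subspace_imp_subspace:
  assumes "complex_vector.subspace (K :: 'a::complex_banach set)"
  shows "subspace K"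
  using assms
  by (auto simp: subspace_def complex_vector.subspace_def simp flip: scaleC_of_real)

lemma complex_subspace_closure:
  assumes "complex_vector.subspace (K :: 'a::complex_banach set)"
  shows "complex_vector.subspace (closure K)"
  unfolding complex_vector.subspace_def
proof (intro conjI ballI allI)
  show "0 \<in> closure K"
    using assms by (meson closure_subset complex_vector.subspace_0 subsetD)
  show "x + y \<in> closure K" if "x \<in> closure K" "y \<in> closure K" for x y
  proof -
    obtain X Y where "\<forall>n. X n \<in> K" "X \<longlonglongrightarrow> x" "\<forall>n. Y n \<in> K" "Y \<longlonglongrightarrow> y"
      using \<open>x \<in> closure K\<close> \<open>y \<in> closure K\<close> unfolding closure_sequential by blast
    then show ?thesis
      unfolding closure_sequential using assms
      by (intro exI[of _ "\<lambda>n. X n + Y n"]) (auto intro: tendsto_add complex_vector.subspace_add)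
  qed
  show "c *\<^sub>C x \<in> closure K" if "x \<in> closure K" for c x
  proof -
    have "(*\<^sub>C) c ` closure K \<subseteq> closure K"
      using assms
      by (intro image_closure_subset)
         (auto intro!: linear_continuous_on bounded_linear_scaleC closure_subset[THEN subsetD]
               simp: complex_vector.subspace_def)
    then show ?thesis using that by auto
  qed
qed

text \<open>Riemann sums are finite real linear combinations of values of \<open>f\<close>, so they
  stay in \<open>K\<close>, and closedness passes this to the integral over a box. For general
  \<open>S\<close> the integrand is extended by \<open>0\<close>, also an element of
  \<open>K\<close>, and the boxes exhaust the space.\<close>

lemma has_integral_in_closed_subspace:
  fixes f :: "'n::euclidean_space \<Rightarrow> 'a::banach"
  assumes K: "subspace K" "closed K"
    and f: "\<And>x. x \<in> S \<Longrightarrow> f x \<in> K" and int: "(f has_integral y) S"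
  shows "y \<in> K"
proof -
  have cbox: "z \<in> K"
    if g: "\<And>x. g x \<in> K" and int: "(g has_integral z) (cbox a b)" for g :: "'n \<Rightarrow> 'a" and z a b
  proof (rule closed_approachable[OF K(2), THEN iffD1], intro allI impI)
    fix e :: real assume "e > 0"
    with int obtain \<gamma> where \<gamma>: "gauge \<gamma>"
      "\<And>\<D>. \<D> tagged_division_of (cbox a b) \<Longrightarrow> \<gamma> fine \<D> \<Longrightarrow>
         norm ((\<Sum>(x, k)\<in>\<D>. measure lborel k *\<^sub>R g x) - z) < e"
      unfolding has_integral by meson
    obtain \<D> where \<D>: "\<D> tagged_division_of (cbox a b)" "\<gamma> fine \<D>"
      using fine_division_exists[OF \<gamma>(1)] by blast
    have "(\<Sum>(x, k)\<in>\<D>. measure lborel k *\<^sub>R g x) \<in> K"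
      by (rule subspace_sum[OF K(1)]) (auto intro: subspace_scale[OF K(1)] g)
    with \<gamma>(2)[OF \<D>] show "\<exists>y\<in>K. dist y z < e"
      by (auto simp: dist_norm)
  qed
  show ?thesis
  proof (rule closed_approachable[OF K(2), THEN iffD1], intro allI impI)
    fix e :: real assume "e > 0"
    with int obtain B where B: "B > 0" "\<And>a b. ball 0 B \<subseteq> cbox a b \<Longrightarrow>
        \<exists>z. ((\<lambda>x. if x \<in> S then f x else 0) has_integral z) (cbox a b) \<and> norm (z - y) < e"
      unfolding has_integral'[of f y S] by meson
    obtain a b where "ball (0::'n) B \<subseteq> cbox a b"
      using bounded_subset_cbox_symmetric[OF bounded_ball] by blast
    then obtain z where z: "((\<lambda>x. if x \<in> S then f x else 0) has_integral z) (cbox a b)"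
      "norm (z - y) < e"
      using B by blast
    have "z \<in> K"
      by (rule cbox[OF _ z(1)]) (auto intro: f subspace_0[OF K(1)])
    with z show "\<exists>z\<in>K. dist z y < e"
      by (auto simp: dist_norm)
  qed
qed


section \<open>The resolvent of a bounded semigroup\<close>

locale bounded_c0_semigroup =
  fixes T :: "real \<Rightarrow> 'a::complex_banach \<Rightarrow> 'a" and N :: real
  assumes c0: "c0_semigroup T"
    and onorm_le: "\<And>t. t \<ge> 0 \<Longrightarrow> onorm (T t) \<le> N"
begin

lemma bounded_linear_T: "t \<ge> 0 \<Longrightarrow> bounded_linear (T t)"
  using c0 by (simp add: c0_semigroup_def bounded_clinear_def)

lemma T_scaleC: "t \<ge> 0 \<Longrightarrow> T t (c *\<^sub>C x) = c *\<^sub>C T t x"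
  using c0 by (simp add: c0_semigroup_def bounded_clinear_def)

lemma T_0: "T 0 x = x"
  using c0 by (simp add: c0_semigroup_def)

lemma T_T: "s \<ge> 0 \<Longrightarrow> t \<ge> 0 \<Longrightarrow> T s (T t x) = T (s + t) x"
  using c0 by (simp add: c0_semigroup_def)

lemma T_at_0: "((\<lambda>t. T t x) \<longlongrightarrow> x) (at_right 0)"
  using c0 by (simp add: c0_semigroup_def)

lemma norm_T: "t \<ge> 0 \<Longrightarrow> norm (T t x) \<le> N * norm x"
  by (meson bounded_linear_T mult_right_mono norm_ge_zero onorm onorm_le order_trans)

lemma N_nonneg: "N \<ge> 0"
  using onorm_pos_le[OF bounded_linear_T[of 0]] onorm_le[of 0] by linarith

text \<open>For \<open>a\<close> \<le> \<open>b\<close> the difference is \<open>T a\<close> applied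
  to \<open>T (b - a) x - x\<close>. By the uniform bound, its size is controlled by
  \<open>b - a\<close> alone, so right continuity at 0 yields continuity from both sides
  everywhere.\<close>

lemma continuous_on_T: "continuous_on {0..} (\<lambda>t. T t x)"
  unfolding continuous_on_iff
proof (intro ballI allI impI)
  fix t e :: real assume t: "t \<in> {0..}" and e: "e > 0"
  \<comment> \<open>\<open>N + 1\<close> instead of \<open>N\<close>, which may be 0.\<close>
  have "eventually (\<lambda>r. dist (T r x) x < e / (N + 1)) (at_right 0)"
    using T_at_0[of x] e N_nonneg by (intro tendstoD) auto
  then obtain d where d: "d > 0" "\<And>r. 0 < r \<Longrightarrow> r < d \<Longrightarrow> dist (T r x) x < e / (N + 1)"
    unfolding eventually_at_right_field by auto
  have *: "dist (T b x) (T a x) < e" if "0 \<le> a" "a \<le> b" "b - a < d" for a b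
  proof (cases "a = b")
    case False
    have "T b x - T a x = T a (T (b - a) x - x)"
      using that by (simp add: linear_diff[OF bounded_linear.linear[OF bounded_linear_T]] T_T)
    then have "dist (T b x) (T a x) \<le> N * dist (T (b - a) x) x"
      using norm_T[of a "T (b - a) x - x"] that by (simp add: dist_norm)
    also have "\<dots> \<le> N * (e / (N + 1))"
      using d(2)[of "b - a"] that False N_nonneg by (intro mult_left_mono) auto
    also have "\<dots> < e"
      using e N_nonneg by (simp add: field_simps)
    finally show ?thesis .
  qed (use e in simp)
  show "\<exists>d>0. \<forall>t'\<in>{0..}. dist t' t < d \<longrightarrow> dist (T t' x) (T t x) < e"
  proof (intro exI[of _ d] conjI ballI impI d)
    fix t' assume "t' \<in> {0..}" "dist t' t < d"
    then show "dist (T t' x) (T t x) < e"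
      using t *[of t t'] *[of t' t] by (cases "t \<le> t'") (auto simp: dist_commute dist_real_def)
  qed
qed

section \<open>The exponentially rescaled semigroup and its Laplace transform\<close>

definition S :: "real \<Rightarrow> real \<Rightarrow> 'a \<Rightarrow> 'a" where
  "S l t x = exp (- l * t) *\<^sub>R T t x"

lemma continuous_on_S: "continuous_on {0..} (\<lambda>t. S l t x)"
  unfolding S_def by (intro continuous_intros continuous_on_T)

lemma S_integrable: "a \<ge> 0 \<Longrightarrow> (\<lambda>t. S l t x) integrable_on {a..b}"
  by (rule integrable_continuous_real, rule continuous_on_subset[OF continuous_on_S]) auto

lemma bounded_linear_S: "t \<ge> 0 \<Longrightarrow> bounded_linear (S l t)"
  unfolding S_def using bounded_linear_T
  by (intro bounded_linear_compose[OF bounded_linear_scaleR_right])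

lemma S_S: "s \<ge> 0 \<Longrightarrow> t \<ge> 0 \<Longrightarrow> S l s (S l t x) = S l (s + t) x"
  by (simp add: S_def linear_scale[OF bounded_linear.linear[OF bounded_linear_T]] T_T
      algebra_simps flip: exp_add)

text \<open>The integrand is dominated by \<open>c * exp (- l * t)\<close>. Large \<open>a\<close>
  gives the tail estimate behind convergence. The orbit bound \<open>c\<close> in place of
  \<open>N * norm x\<close> later permits iterating resolvents without collecting powers of
  \<open>N\<close>.\<close>

lemma norm_integral_S_le:
  assumes "l > 0" "0 \<le> a" "a \<le> b" and c: "\<And>t. t \<ge> 0 \<Longrightarrow> norm (T t x) \<le> c"
  shows "norm (integral {a..b} (\<lambda>t. S l t x)) \<le> c * exp (- l * a) / l"
proof -
  have exp: "((\<lambda>t. c * exp (- l * t)) has_integral - c * exp (- l * b) / l - - c * exp (- l * a) / l) {a..b}"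
    using assms by (intro fundamental_theorem_of_calculus)
      (auto intro!: derivative_eq_intros simp flip: has_real_derivative_iff_has_vector_derivative)
  have "norm (integral {a..b} (\<lambda>t. S l t x)) \<le> integral {a..b} (\<lambda>t. c * exp (- l * t))"
    using assms
    by (intro integral_norm_bound_integral S_integrable has_integral_integrable[OF exp])
       (auto simp: S_def mult.commute)
  also have "\<dots> = c * exp (- l * a) / l - c * exp (- l * b) / l"
    using integral_unique[OF exp] by simp
  also have "\<dots> \<le> c * exp (- l * a) / l"
  proof -
    have "c \<ge> 0" using c[of 0] norm_ge_zero[of "T 0 x"] by linarith
    then show ?thesis using \<open>l > 0\<close> by simp
  qed
  finally show ?thesis .
qed

text \<open>The Laplace transform of the semigroup, which is \<open>(l - A)\<^sup>-\<^sup>1\<close>.\<close>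

definition J :: "real \<Rightarrow> 'a \<Rightarrow> 'a" where
  "J l x = lim (\<lambda>n. integral {0..real n} (\<lambda>t. S l t x))"

lemma J_tendsto:
  assumes "l > 0"
  shows "(\<lambda>n. integral {0..real n} (\<lambda>t. S l t x)) \<longlonglongrightarrow> J l x"
proof -
  let ?I = "\<lambda>n. integral {0..real n} (\<lambda>t. S l t x)"
  have le: "dist (?I m) (?I n) \<le> N * norm x * exp (- l * real m) / l" if "m \<le> n" for m n
  proof -
    have "?I m + integral {real m..real n} (\<lambda>t. S l t x) = ?I n"
      using that by (intro Henstock_Kurzweil_Integration.integral_combine S_integrable) auto
    then have "?I n - ?I m = integral {real m..real n} (\<lambda>t. S l t x)"
      by (simp add: algebra_simps)
    then show ?thesis
      using norm_integral_S_le[OF assms, of "real m" "real n" x "N * norm x"] that norm_T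
      by (simp add: dist_norm norm_minus_commute[of "?I m"])
  qed
  have lim: "(\<lambda>m. N * norm x * exp (- l * real m) / l) \<longlonglongrightarrow> 0"
  proof -
    have "(\<lambda>m. exp (- l) ^ m) \<longlonglongrightarrow> 0"
      using assms by (intro LIMSEQ_power_zero) simp
    then have "(\<lambda>m. N * norm x * exp (- l) ^ m / l) \<longlonglongrightarrow> 0"
      using tendsto_divide_zero tendsto_mult_right_zero by blast
    then show ?thesis by (simp add: exp_of_nat_mult[symmetric] mult.commute)
  qed
  have "Cauchy ?I"
    unfolding Cauchy_altdef
  proof (intro allI impI)
    fix e :: real assume "e > 0"
    with lim have "eventually (\<lambda>m. N * norm x * exp (- l * real m) / l < e) sequentially"
      by (simp add: order_tendstoD(2))
    then obtain M where "\<And>m. m \<ge> M \<Longrightarrow> N * norm x * exp (- l * real m) / l < e"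
      by (auto simp: eventually_sequentially)
    then show "\<exists>M. \<forall>m\<ge>M. \<forall>n>m. dist (?I m) (?I n) < e"
      using le by (meson le_less_trans less_imp_le)
  qed
  then show ?thesis
    unfolding J_def by (simp add: Cauchy_convergent_iff convergent_LIMSEQ_iff)
qed

lemma T_J:
  assumes "l > 0" "s \<ge> 0"
  shows "T s (J l x) = J l (T s x)"
proof (rule LIMSEQ_unique)
  have "T s (integral {0..real n} (\<lambda>t. S l t x)) = integral {0..real n} (\<lambda>t. S l t (T s x))" for n
  proof -
    have "T s (integral {0..real n} (\<lambda>t. S l t x)) = integral {0..real n} (T s \<circ> (\<lambda>t. S l t x))"
      using assms by (simp add: integral_linear S_integrable bounded_linear_T)
    also have "\<dots> = integral {0..real n} (\<lambda>t. S l t (T s x))"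
      using assms by (intro integral_cong)
        (simp add: S_def linear_scale[OF bounded_linear.linear[OF bounded_linear_T]] T_T add.commute)
    finally show ?thesis .
  qed
  then show "(\<lambda>n. T s (integral {0..real n} (\<lambda>t. S l t x))) \<longlonglongrightarrow> J l (T s x)"
    using J_tendsto[OF assms(1)] by simp
  show "(\<lambda>n. T s (integral {0..real n} (\<lambda>t. S l t x))) \<longlonglongrightarrow> T s (J l x)"
    using assms by (intro bounded_linear.tendsto[OF bounded_linear_T] J_tendsto)
qed

lemma norm_J_le:
  assumes "l > 0" "\<And>t. t \<ge> 0 \<Longrightarrow> norm (T t x) \<le> c"
  shows "norm (J l x) \<le> c / l"
proof (rule LIMSEQ_le_const2[OF tendsto_norm[OF J_tendsto[OF assms(1)]]], intro exI allI impI)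
  show "norm (integral {0..real n} (\<lambda>t. S l t x)) \<le> c / l" for n
    using norm_integral_S_le[of l 0 "real n" x c] assms by simp
qed

lemma norm_J: "l > 0 \<Longrightarrow> norm (J l x) \<le> N / l * norm x"
  using norm_J_le[of l x "N * norm x"] norm_T by simp

lemma bounded_linear_J:
  assumes "l > 0"
  shows "bounded_linear (J l)"
proof
  have S: "linear (S l t)" if "t \<ge> 0" for t
    using that bounded_linear_S bounded_linear.linear by blast
  show "J l (x + y) = J l x + J l y" for x y
  proof (rule LIMSEQ_unique[OF J_tendsto[OF assms]])
    have "integral {0..real n} (\<lambda>t. S l t (x + y)) =
        integral {0..real n} (\<lambda>t. S l t x) + integral {0..real n} (\<lambda>t. S l t y)" for n
      by (subst integral_add[symmetric]) (auto intro!: S_integrable integral_cong simp: linear_add[OF S])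
    then show "(\<lambda>n. integral {0..real n} (\<lambda>t. S l t (x + y))) \<longlonglongrightarrow> J l x + J l y"
      by (simp add: tendsto_add J_tendsto assms)
  qed
  show "J l (r *\<^sub>R x) = r *\<^sub>R J l x" for r x
  proof (rule LIMSEQ_unique[OF J_tendsto[OF assms]])
    have "integral {0..real n} (\<lambda>t. S l t (r *\<^sub>R x)) = r *\<^sub>R integral {0..real n} (\<lambda>t. S l t x)" for n
      unfolding integral_cmul[symmetric] by (intro integral_cong) (simp add: linear_scale[OF S])
    then show "(\<lambda>n. integral {0..real n} (\<lambda>t. S l t (r *\<^sub>R x))) \<longlonglongrightarrow> r *\<^sub>R J l x"
      by (simp add: tendsto_scaleR J_tendsto assms)
  qed
  show "\<exists>K. \<forall>x. norm (J l x) \<le> norm x * K"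
    using norm_J[OF assms] by (metis mult.commute)
qed

text \<open>Applying \<open>S l h\<close> shifts the integral over the half-line to start at
  \<open>h\<close>, so the difference is minus the missing piece over \<open>{0..h}\<close>. On the
  truncated interval an end piece over \<open>{n..n + h}\<close> remains, and it vanishes in the
  limit.\<close>

lemma S_J_diff:
  assumes "l > 0" "h \<ge> 0"
  shows "S l h (J l x) - J l x = - integral {0..h} (\<lambda>t. S l t x)"
proof (rule LIMSEQ_unique)
  let ?I = "\<lambda>a b. integral {a..b} (\<lambda>t. S l t x)"
  have eq: "S l h (?I 0 (real n)) - ?I 0 (real n) = ?I (real n) (real n + h) - ?I 0 h" for n
  proof -
    have "S l h (?I 0 (real n)) = integral {0..real n} (S l h \<circ> (\<lambda>t. S l t x))"
      using assms by (simp add: integral_linear S_integrable bounded_linear_S)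
    also have "\<dots> = integral {0..real n} ((\<lambda>t. S l t x) \<circ> (+) h)"
      using assms by (intro integral_cong) (simp add: S_S)
    also have "\<dots> = ?I h (real n + h)"
      using integrable_integral[OF S_integrable[of h l x "real n + h"]] assms
      by (intro integral_unique) (simp only: has_integral_shift_Icc_real add_0)
    finally have "S l h (?I 0 (real n)) = ?I h (real n + h)" .
    moreover have "?I 0 h + ?I h (real n + h) = ?I 0 (real n + h)"
      using assms by (intro Henstock_Kurzweil_Integration.integral_combine S_integrable) auto
    moreover have "?I 0 (real n) + ?I (real n) (real n + h) = ?I 0 (real n + h)"
      using assms by (intro Henstock_Kurzweil_Integration.integral_combine S_integrable) auto
    ultimately show ?thesis
      by (simp add: algebra_simps)
  qed
  have "(\<lambda>n. ?I (real n) (real n + h)) \<longlonglongrightarrow> 0"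
  proof (rule Lim_null_comparison)
    show "\<forall>\<^sub>F n in sequentially. norm (?I (real n) (real n + h)) \<le> N * norm x / l * exp (- l) ^ n"
      using norm_integral_S_le[of l "real n" "real n + h" x "N * norm x" for n] assms norm_T
      by (intro always_eventually) (simp add: exp_of_nat_mult[symmetric] mult.commute)
    show "(\<lambda>n. N * norm x / l * exp (- l) ^ n) \<longlonglongrightarrow> 0"
      using assms by (intro tendsto_mult_right_zero LIMSEQ_power_zero) simp
  qed
  from tendsto_diff[OF this tendsto_const[of "?I 0 h"]]
  show "(\<lambda>n. S l h (?I 0 (real n)) - ?I 0 (real n)) \<longlonglongrightarrow> - ?I 0 h"
    by (simp add: eq)
  show "(\<lambda>n. S l h (?I 0 (real n)) - ?I 0 (real n)) \<longlonglongrightarrow> S l h (J l x) - J l x"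
    using assms by (intro tendsto_diff bounded_linear.tendsto[OF bounded_linear_S] J_tendsto)
qed

text \<open>Dividing the previous identity by \<open>h\<close>, the fundamental theorem of calculus
  at 0 gives the limit. It says that \<open>l - A\<close> maps \<open>J l x\<close> to
  \<open>x\<close>.\<close>

lemma S_J_derivative:
  assumes "l > 0"
  shows "((\<lambda>h. (S l h (J l x) - J l x) /\<^sub>R h) \<longlongrightarrow> - x) (at_right 0)"
proof -
  have "((\<lambda>u. integral {0..u} (\<lambda>t. S l t x)) has_vector_derivative S l 0 x) (at 0 within {0..1})"
    by (rule integral_has_vector_derivative, rule continuous_on_subset[OF continuous_on_S]) auto
  then have "((\<lambda>h. (1 / \<bar>h\<bar>) *\<^sub>R (integral {0..h} (\<lambda>t. S l t x) - h *\<^sub>R x)) \<longlongrightarrow> 0) (at_right 0)"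
    by (simp add: has_vector_derivative_def has_derivative_within S_def T_0 at_within_Icc_at_right)
  moreover have "\<forall>\<^sub>F h in at_right 0. (1 / \<bar>h\<bar>) *\<^sub>R (integral {0..h} (\<lambda>t. S l t x) - h *\<^sub>R x) =
      integral {0..h} (\<lambda>t. S l t x) /\<^sub>R h - x"
    by (auto simp: eventually_at_right_field divide_inverse scaleR_diff_right intro!: exI[of _ 1])
  ultimately have "((\<lambda>h. integral {0..h} (\<lambda>t. S l t x) /\<^sub>R h) \<longlongrightarrow> x) (at_right 0)"
    by (simp add: LIM_zero_iff cong: tendsto_cong)
  from tendsto_minus[OF this] show ?thesis
    by (rule Lim_transform_eventually)
       (auto simp: eventually_at_right_field S_J_diff assms intro!: exI[of _ 1])
qed

text \<open>The generator of \<open>S l\<close> is \<open>A - l\<close>. Both directions are the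
  product rule at 0, with the factor \<open>exp (- l * h)\<close> for one and
  \<open>exp (l * h)\<close> for its removal.\<close>

lemma generator_iff_S:
  "(x, y) \<in> generator T \<longleftrightarrow> ((\<lambda>h. (S l h x - x) /\<^sub>R h) \<longlongrightarrow> y - l *\<^sub>R x) (at_right 0)"
proof -
  have "((\<lambda>h. exp (- l * h)) has_real_derivative - l) (at 0 within {0<..})"
    by (auto intro!: derivative_eq_intros)
  then have e: "((\<lambda>h. (exp (- l * h) - 1) / h) \<longlongrightarrow> - l) (at_right 0)"
    by (simp add: has_field_derivative_iff)
  have e': "((\<lambda>h. (exp (l * h) - 1) / h) \<longlongrightarrow> l) (at_right 0)"
  proof -
    have "((\<lambda>h. exp (l * h)) has_real_derivative l) (at 0 within {0<..})"
      by (auto intro!: derivative_eq_intros)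
    then show ?thesis by (simp add: has_field_derivative_iff)
  qed
  have exp: "((\<lambda>h. exp (c * h)) \<longlongrightarrow> 1) (at_right 0)" for c :: real
    by (rule tendsto_eq_intros | simp)+
  show ?thesis
  proof
    assume "(x, y) \<in> generator T"
    then have "((\<lambda>h. (T h x - x) /\<^sub>R h) \<longlongrightarrow> y) (at_right 0)"
      by (simp add: generator_def)
    from tendsto_add[OF tendsto_scaleR[OF exp[of "- l"] this] tendsto_scaleR[OF e tendsto_const[of x]]]
    show "((\<lambda>h. (S l h x - x) /\<^sub>R h) \<longlongrightarrow> y - l *\<^sub>R x) (at_right 0)"
      by (simp add: S_def algebra_simps divide_inverse)
  next
    assume S: "((\<lambda>h. (S l h x - x) /\<^sub>R h) \<longlongrightarrow> y - l *\<^sub>R x) (at_right 0)"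
    have [simp]: "(inverse h * exp (h * l)) *\<^sub>R S l h x = T h x /\<^sub>R h" for h
      by (simp add: S_def mult.commute flip: exp_add)
    from tendsto_add[OF tendsto_scaleR[OF exp[of l] S] tendsto_scaleR[OF e' tendsto_const[of x]]]
    show "(x, y) \<in> generator T"
      by (simp add: generator_def algebra_simps divide_inverse)
  qed
qed

section \<open>\<open>J l\<close> as the inverse of \<open>l - A\<close>\<close>

lemma J_generator: "l > 0 \<Longrightarrow> (J l x, l *\<^sub>R J l x - x) \<in> generator T"
  using S_J_derivative[of l x] generator_iff_S[of "J l x" "l *\<^sub>R J l x - x" l] by simp

text \<open>\<open>J l\<close> commutes with \<open>S l h\<close>. Hence \<open>J l\<close> applied
  to the difference quotient of \<open>y\<close> has two limits: \<open>- J l x\<close> by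
  continuity of \<open>J l\<close>, and \<open>- y\<close> by \<open>S_J_derivative\<close>.\<close>

lemma J_unique:
  assumes "l > 0" "(y, l *\<^sub>R y - x) \<in> generator T"
  shows "J l x = y"
proof -
  interpret J: bounded_linear "J l"
    using bounded_linear_J[OF assms(1)] .
  have "((\<lambda>h. (S l h y - y) /\<^sub>R h) \<longlongrightarrow> - x) (at_right 0)"
    using assms(2) generator_iff_S[of y "l *\<^sub>R y - x" l] by simp
  from J.tendsto[OF this]
  have "((\<lambda>h. (J l (S l h y) - J l y) /\<^sub>R h) \<longlongrightarrow> - J l x) (at_right 0)"
    by (simp add: J.scaleR J.diff J.neg)
  moreover have "\<forall>\<^sub>F h in at_right 0. (J l (S l h y) - J l y) /\<^sub>R h = (S l h (J l y) - J l y) /\<^sub>R h"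
    by (auto simp: eventually_at_right_field S_def J.scaleR T_J assms(1) intro!: exI[of _ 1])
  ultimately have "((\<lambda>h. (S l h (J l y) - J l y) /\<^sub>R h) \<longlongrightarrow> - J l x) (at_right 0)"
    by (simp cong: tendsto_cong)
  with S_J_derivative[OF assms(1), of y] have "- J l x = - y"
    by (metis tendsto_unique trivial_limit_at_right_real)
  then show ?thesis by simp
qed

lemma generator_scaleC:
  assumes "(x, y) \<in> generator T"
  shows "(c *\<^sub>C x, c *\<^sub>C y) \<in> generator T"
proof -
  interpret C: bounded_linear "\<lambda>x::'a. c *\<^sub>C x"
    by (rule bounded_linear_scaleC)
  from assms have "((\<lambda>h. (T h x - x) /\<^sub>R h) \<longlongrightarrow> y) (at_right 0)"
    by (simp add: generator_def)
  from C.tendsto[OF this]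
  have "((\<lambda>h. (c *\<^sub>C T h x - c *\<^sub>C x) /\<^sub>R h) \<longlongrightarrow> c *\<^sub>C y) (at_right 0)"
    by (simp add: C.scaleR C.diff)
  moreover have "\<forall>\<^sub>F h in at_right 0. (c *\<^sub>C T h x - c *\<^sub>C x) /\<^sub>R h = (T h (c *\<^sub>C x) - c *\<^sub>C x) /\<^sub>R h"
    by (auto simp: eventually_at_right_field T_scaleC intro!: exI[of _ 1])
  ultimately show ?thesis
    by (simp add: generator_def cong: tendsto_cong)
qed

lemma J_scaleC:
  assumes "l > 0"
  shows "J l (c *\<^sub>C x) = c *\<^sub>C J l x"
proof (rule J_unique[OF assms])
  interpret C: bounded_linear "\<lambda>x::'a. c *\<^sub>C x"
    by (rule bounded_linear_scaleC)
  show "(c *\<^sub>C J l x, l *\<^sub>R c *\<^sub>C J l x - c *\<^sub>C x) \<in> generator T"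
    using generator_scaleC[OF J_generator[OF assms], of c x] by (simp add: C.diff C.scaleR)
qed

lemma resolvent_op_generator:
  assumes "l > 0"
  shows "resolvent_op l (generator T) = {(x, J l x) | x. True}"
proof -
  have "(x, y) \<in> resolvent_op l (generator T) \<longleftrightarrow> y = J l x" for x y
  proof
    assume "(x, y) \<in> resolvent_op l (generator T)"
    then obtain z where "(y, z) \<in> generator T" "x = l *\<^sub>R y - z"
      by (auto simp: resolvent_op_def minus_op_def)
    then show "y = J l x"
      using J_unique[OF assms, of y x] by simp
  next
    assume "y = J l x"
    then show "(x, y) \<in> resolvent_op l (generator T)"
      using J_generator[OF assms, of x] by (force simp: resolvent_op_def minus_op_def)
  qed
  then show ?thesis by auto
qed


section \<open>Invariant subspaces\<close>

text \<open>For \<open>x \<in> K\<close> the resolvent equation exhibits \<open>J l x\<close> as the fixed point of a contraction of \<open>K\<close>.\<close>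

lemma J_invariant_step:
  assumes K: "subspace K" "closed K" and "J m ` K \<subseteq> K"
    and pos: "m > 0" "l > 0" and contr: "\<bar>m - l\<bar> * N < m"
  shows "J l ` K \<subseteq> K"
proof safe
  fix x assume x: "x \<in> K"
  interpret J: bounded_linear "J m"
    using bounded_linear_J[OF pos(1)] .
  \<comment> \<open>\<open>(l - A) y = x\<close> is equivalent to
    \<open>(m - A) y = x + (m - l) y\<close>, so \<open>J l x\<close> is a fixed point of
    \<open>F\<close>.\<close>
  define F where "F y = J m (x + (m - l) *\<^sub>R y)" for y
  define c where "c = \<bar>m - l\<bar> * N / m"
  have c: "0 \<le> c" "c < 1"
    using pos contr N_nonneg by (auto simp: c_def)
  have lip: "dist (F y) (F z) \<le> c * dist y z" for y z
  proof -
    have "F y - F z = J m ((m - l) *\<^sub>R (y - z))"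
      by (simp add: F_def J.diff J.add J.scaleR algebra_simps)
    then show ?thesis
      using norm_J[OF pos(1), of "(m - l) *\<^sub>R (y - z)"]
      by (simp add: dist_norm c_def mult_ac)
  qed
  have "F ` K \<subseteq> K"
    using assms(3) x by (auto simp: F_def intro!: subspace_add[OF K(1)] subspace_scale[OF K(1)])
  with lip c K obtain y where y: "y \<in> K" "F y = y"
    using Banach_fix[of K c F] x by (auto simp: complete_eq_closed)
  have "(J l x, m *\<^sub>R J l x - (x + (m - l) *\<^sub>R J l x)) \<in> generator T"
    using J_generator[OF pos(2), of x] by (simp add: algebra_simps)
  then have "F (J l x) = J l x"
    unfolding F_def by (rule J_unique[OF pos(1)])
  \<comment> \<open>Uniqueness is taken in the whole space, because \<open>J l x\<close> is not yet
    known to lie in \<open>K\<close>.\<close>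
  with y have "J l x = y"
    using banach_fix_type[of c F] c lip by auto
  with y show "J l x \<in> K" by simp
qed

text \<open>One step may enlarge the parameter by the factor \<open>q\<close>, since
  \<open>(q - 1) * N < 1\<close>. This factor does not depend on the parameter, so finitely many
  steps reach every \<open>l\<close> \<ge> \<open>m\<close>.\<close>

lemma J_invariant:
  assumes K: "subspace K" "closed K" "J m ` K \<subseteq> K" and "m > 0" "l \<ge> m"
  shows "J l ` K \<subseteq> K"
proof -
  define q where "q = 1 + 1 / (N + 1)"
  have q: "q > 1" using N_nonneg by (simp add: q_def)
  have *: "J l ` K \<subseteq> K" if "m \<le> l" "l \<le> m * q ^ n" for l n
    using that
  proof (induction n arbitrary: l)
    case 0
    then show ?case using K by simp
  next
    case (Suc n)
    \<comment> \<open>The previous parameter: within a factor \<open>q\<close> below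
      \<open>l\<close>, but kept at least \<open>m\<close> so that the induction hypothesis
      applies.\<close>
    define r where "r = max m (l / q)"
    have r: "m \<le> r" "r \<le> m * q ^ n" "r > 0" "r \<le> l" "l \<le> r * q"
      using Suc.prems \<open>m > 0\<close> q
      by (auto simp: r_def field_simps max_def intro: mult_left_mono)
    show ?case
    proof (rule J_invariant_step[OF K(1,2) Suc.IH[OF r(1,2)] r(3)])
      show "l > 0" using Suc.prems \<open>m > 0\<close> by linarith
      have "(l - r) * N \<le> (r * q - r) * N"
        using r N_nonneg by (intro mult_right_mono) auto
      also have "\<dots> = r * (N / (N + 1))"
        by (simp add: q_def algebra_simps)
      also have "\<dots> < r * 1"
        using r(3) N_nonneg by (intro mult_strict_left_mono) auto
      finally show "\<bar>r - l\<bar> * N < r"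
        using r by simp
    qed
  qed
  obtain n where "l / m < q ^ n"
    using real_arch_pow[OF q] by blast
  with assms show ?thesis
    by (intro *[of l n]) (auto simp: field_simps)
qed

section \<open>Implicit Euler approximation of the semigroup\<close>

text \<open>The implicit Euler step \<open>(1 - h A)\<^sup>-\<^sup>1\<close>.\<close>

definition E :: "real \<Rightarrow> 'a \<Rightarrow> 'a" where
  "E h x = J (1 / h) x /\<^sub>R h"

lemma bounded_linear_E: "h > 0 \<Longrightarrow> bounded_linear (E h)"
  unfolding E_def
  by (intro bounded_linear_compose[OF bounded_linear_scaleR_right] bounded_linear_J) simp

lemma T_E: "h > 0 \<Longrightarrow> t \<ge> 0 \<Longrightarrow> T t (E h x) = E h (T t x)"
  by (simp add: E_def linear_scale[OF bounded_linear.linear[OF bounded_linear_T]] T_J)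

text \<open>
  The orbit bound \<open>\<forall>t\<ge>0. norm (T t x) \<le> c\<close> plays the part of an equivalent norm under which both
  \<open>T t\<close> and \<open>E h\<close> are contractions.
\<close>

lemma norm_T_E_le:
  assumes "h > 0" "t \<ge> 0" "\<And>s. s \<ge> 0 \<Longrightarrow> norm (T s x) \<le> c"
  shows "norm (T t (E h x)) \<le> c"
proof -
  have "norm (J (1 / h) (T t x)) \<le> c / (1 / h)"
    using assms by (intro norm_J_le) (auto simp: T_T)
  then show ?thesis
    using assms by (simp add: T_E) (simp add: E_def field_simps)
qed

lemma norm_E: "h > 0 \<Longrightarrow> norm (E h x) \<le> N * norm x"
  using norm_T_E_le[of h 0 x "N * norm x"] norm_T by (simp add: T_0)

lemma E_generator:
  assumes "h > 0" "(x, y) \<in> generator T"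
  shows "E h x = x + h *\<^sub>R E h y"
proof -
  interpret J: bounded_linear "J (1 / h)"
    using assms by (intro bounded_linear_J) simp
  have "J (1 / h) ((1 / h) *\<^sub>R x - y) = x"
    using assms by (intro J_unique) auto
  then show ?thesis
    using assms by (simp add: E_def J.diff J.scaleR field_simps)
qed

text \<open>The negated difference quotient of \<open>J 1 x\<close> tends to \<open>x\<close>. Since
  \<open>J 1\<close> commutes with the semigroup, it is itself a value of \<open>J 1\<close>, hence
  in the domain.\<close>

lemma generator_dense:
  assumes "e > 0"
  shows "\<exists>u y. (u, y) \<in> generator T \<and> norm (u - x) < e"
proof -
  interpret J: bounded_linear "J 1"
    by (rule bounded_linear_J) simp
  have "\<forall>\<^sub>F h in at_right 0. dist ((S 1 h (J 1 x) - J 1 x) /\<^sub>R h) (- x) < e"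
    using S_J_derivative[of 1 x] assms by (simp add: tendstoD)
  then obtain h where h: "h > 0" "dist ((S 1 h (J 1 x) - J 1 x) /\<^sub>R h) (- x) < e"
    unfolding eventually_at_right_field by (meson dense)
  define u where "u = J 1 ((x - S 1 h x) /\<^sub>R h)"
  have "u = - ((S 1 h (J 1 x) - J 1 x) /\<^sub>R h)"
    using h by (simp add: u_def S_def J.scaleR J.diff T_J algebra_simps)
  with h have "norm (u - x) < e"
    by (simp add: dist_norm norm_minus_commute add.commute)
  then show ?thesis
    using J_generator[of 1] unfolding u_def by (meson zero_less_one)
qed

text \<open>On the domain \<open>E h u - u\<close> equals \<open>h *\<^sub>R E h y\<close>, which is
  of order \<open>h\<close>. Density and the uniform bound \<open>norm_E\<close> extend the
  convergence to all \<open>x\<close>.\<close>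

lemma E_tendsto: "((\<lambda>h. E h x) \<longlongrightarrow> x) (at_right 0)"
proof (rule tendstoI)
  fix e :: real assume "e > 0"
  \<comment> \<open>Three errors are balanced: \<open>N * d\<close> from \<open>E h (x - u)\<close>,
    and \<open>d\<close> from each of the other two terms.\<close>
  define d where "d = e / (N + 2)"
  have d: "d > 0" and e: "e = N * d + d + d"
    using \<open>e > 0\<close> N_nonneg by (auto simp: d_def simp flip: add_divide_distrib) (simp add: field_simps)
  obtain u y where u: "(u, y) \<in> generator T" "norm (u - x) < d"
    using generator_dense[OF d] by blast
  have "((\<lambda>h. h * (N * norm y)) \<longlongrightarrow> 0) (at_right 0)"
    by (rule tendsto_eq_intros | simp)+
  then have "\<forall>\<^sub>F h in at_right 0. h * (N * norm y) < d"
    using d by (simp add: order_tendstoD(2))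
  moreover have "\<forall>\<^sub>F h in at_right (0::real). h > 0"
    by (simp add: eventually_at_right_less)
  ultimately show "\<forall>\<^sub>F h in at_right 0. dist (E h x) x < e"
  proof eventually_elim
    case (elim h)
    interpret E: bounded_linear "E h"
      using elim bounded_linear_E by blast
    have "E h x - x = E h (x - u) + h *\<^sub>R E h y + (u - x)"
      using E_generator[OF elim(2) u(1)] by (simp add: E.diff)
    then have "norm (E h x - x) \<le> norm (E h (x - u)) + norm (h *\<^sub>R E h y) + norm (u - x)"
      by (metis norm_triangle_le norm_triangle_ineq add_mono order_refl)
    moreover have "norm (E h (x - u)) \<le> N * d"
      using norm_E[OF elim(2), of "x - u"] u(2) N_nonneg
        mult_left_mono[of "norm (x - u)" d N] by (simp add: norm_minus_commute)
    moreover have "norm (h *\<^sub>R E h y) \<le> h * (N * norm y)"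
      using norm_E[OF elim(2), of y] elim(2) by simp
    ultimately show ?case
      using u(2) elim(1) by (simp add: dist_norm e)
  qed
qed

text \<open>Stability of the scheme: the global error telescopes into \<open>n\<close> local errors.
  Measured along whole orbits, \<open>E h\<close> does not enlarge them, so the bound is linear in
  \<open>n\<close>. This is why the statement carries a free \<open>s\<close>, over which the
  induction generalizes.\<close>

lemma norm_E_power_diff_le:
  assumes "h > 0" and c: "\<And>s. s \<ge> 0 \<Longrightarrow> norm (T s (E h x - T h x)) \<le> c" and "s \<ge> 0"
  shows "norm (T s ((E h ^^ n) x - T (real n * h) x)) \<le> real n * c"
  using \<open>s \<ge> 0\<close>
proof (induction n arbitrary: s)
  case 0
  then show ?case
    by (simp add: T_0 linear_0[OF bounded_linear.linear[OF bounded_linear_T]])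
next
  case (Suc n)
  interpret E: bounded_linear "E h"
    using assms(1) by (rule bounded_linear_E)
  have T: "linear (T t)" if "t \<ge> 0" for t
    using that bounded_linear_T bounded_linear.linear by blast
  have nh: "real n * h \<ge> 0" using assms by simp
  have "(E h ^^ Suc n) x - T (real (Suc n) * h) x =
      E h ((E h ^^ n) x - T (real n * h) x) + T (real n * h) (E h x - T h x)"
    using assms(1) nh by (simp add: E.diff linear_diff[OF T] T_E T_T algebra_simps)
  then have eq: "T s ((E h ^^ Suc n) x - T (real (Suc n) * h) x) =
      T s (E h ((E h ^^ n) x - T (real n * h) x)) + T (s + real n * h) (E h x - T h x)"
    using Suc.prems nh by (simp add: linear_add[OF T] T_T)
  have "norm (T s (E h ((E h ^^ n) x - T (real n * h) x))) \<le> real n * c"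
    by (rule norm_T_E_le[OF assms(1) Suc.prems Suc.IH])
  moreover have "norm (T (s + real n * h) (E h x - T h x)) \<le> c"
    using Suc.prems nh by (intro c) simp
  ultimately show ?case
    unfolding eq by (intro norm_triangle_le) (simp add: distrib_right)
qed

text \<open>Consistency: the local error divided by \<open>h\<close> is the norm of
  \<open>E h y\<close> minus the difference quotient of \<open>x\<close>, and both of these tend to
  \<open>y\<close>.\<close>

lemma euler_error_tendsto:
  assumes "(x, y) \<in> generator T"
  shows "((\<lambda>h. norm (E h x - T h x) / h) \<longlongrightarrow> 0) (at_right 0)"
proof -
  have "((\<lambda>h. (T h x - x) /\<^sub>R h) \<longlongrightarrow> y) (at_right 0)"
    using assms by (simp add: generator_def)
  from tendsto_norm[OF tendsto_diff[OF E_tendsto[of y] this]]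
  have "((\<lambda>h. norm (E h y - (T h x - x) /\<^sub>R h)) \<longlongrightarrow> 0) (at_right 0)"
    by simp
  moreover have "\<forall>\<^sub>F h in at_right 0. norm (E h y - (T h x - x) /\<^sub>R h) = norm (E h x - T h x) / h"
    unfolding eventually_at_right_field
  proof (intro exI[of _ 1] conjI allI impI)
    fix h :: real assume "h > 0"
    then have "E h x - T h x = h *\<^sub>R (E h y - (T h x - x) /\<^sub>R h)"
      using E_generator[OF _ assms] by (simp add: algebra_simps)
    with \<open>h > 0\<close> show "norm (E h y - (T h x - x) /\<^sub>R h) = norm (E h x - T h x) / h"
      by simp
  qed simp
  ultimately show ?thesis
    by (simp cong: tendsto_cong)
qed

lemma filterlim_const_over_n_at_right:
  fixes t :: real
  assumes "t > 0"
  shows "filterlim (\<lambda>n. t / real n) (at_right 0) sequentially"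
  unfolding filterlim_at
  using assms by (auto intro!: lim_const_over_n eventually_sequentiallyI[of 1])

text \<open>Stability and consistency combined: with \<open>n = t / h\<close> steps, the global
  error is at most \<open>t * N\<close> times the local error divided by \<open>h\<close>.\<close>

lemma euler_tendsto:
  assumes "(x, y) \<in> generator T" "t > 0"
  shows "(\<lambda>n. (E (t / real n) ^^ n) x) \<longlonglongrightarrow> T t x"
proof -
  have "(\<lambda>n. norm (E (t / real n) x - T (t / real n) x) / (t / real n)) \<longlonglongrightarrow> 0"
    by (rule filterlim_compose[OF euler_error_tendsto[OF assms(1)]
          filterlim_const_over_n_at_right[OF assms(2)]])
  from tendsto_mult_right_zero[OF this, of "t * N"]
  have "(\<lambda>n. t * N * (norm (E (t / real n) x - T (t / real n) x) / (t / real n))) \<longlonglongrightarrow> 0" .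
  moreover have "\<forall>\<^sub>F n in sequentially. norm ((E (t / real n) ^^ n) x - T t x) \<le>
      t * N * (norm (E (t / real n) x - T (t / real n) x) / (t / real n))"
  proof (rule eventually_sequentiallyI[of 1])
    fix n :: nat assume "n \<ge> 1"
    define h where "h = t / real n"
    have h: "h > 0" "t = real n * h"
      using \<open>n \<ge> 1\<close> assms(2) by (auto simp: h_def)
    have "norm (T 0 ((E h ^^ n) x - T (real n * h) x)) \<le> real n * (N * norm (E h x - T h x))"
      using h(1) norm_T by (intro norm_E_power_diff_le) auto
    also have "\<dots> = t * N * (norm (E h x - T h x) / h)"
      using h(1) by (simp add: h(2))
    finally show "norm ((E (t / real n) ^^ n) x - T t x) \<le>
        t * N * (norm (E (t / real n) x - T (t / real n) x) / (t / real n))"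
      by (simp only: T_0 h_def[symmetric] flip: h(2))
  qed
  ultimately have "(\<lambda>n. (E (t / real n) ^^ n) x - T t x) \<longlonglongrightarrow> 0"
    by (rule Lim_null_comparison[rotated])
  then show ?thesis
    by (simp add: LIM_zero_iff)
qed

text \<open>For \<open>h\<close> \<le> \<open>1 / g\<close> the resolvent parameter
  \<open>1 / h\<close> is at least \<open>g\<close>, so \<open>E h\<close> preserves
  \<open>K\<close>. Euler approximations starting in \<open>K\<close> therefore remain there, and so
  does their limit.\<close>

lemma T_invariant:
  assumes K: "subspace K" "closed K" "J g ` K \<subseteq> K" and "g > 0" "t \<ge> 0"
  shows "T t ` K \<subseteq> K"
proof safe
  fix x assume x: "x \<in> K"
  have E: "E h z \<in> K" if "z \<in> K" "h > 0" "h \<le> 1 / g" for z h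
    using J_invariant[OF K \<open>g > 0\<close>, of "1 / h"] that \<open>g > 0\<close>
    by (auto simp: E_def field_simps intro!: subspace_scale[OF K(1)])
  have small: "\<forall>\<^sub>F n in sequentially. 0 < s / real n \<and> s / real n \<le> 1 / g" if "s > 0" for s
  proof -
    have "\<forall>\<^sub>F h in at_right 0. 0 < h \<and> h \<le> 1 / g"
      unfolding eventually_at_right_field using \<open>g > 0\<close> by (intro exI[of _ "1 / g"]) auto
    then show ?thesis
      using filterlim_const_over_n_at_right[OF that] by (auto simp: filterlim_iff)
  qed
  show "T t x \<in> K"
  proof (cases "t = 0")
    case False
    with \<open>t \<ge> 0\<close> have t: "t > 0" by simp
    have gen: "T t u \<in> K" if u: "u \<in> K" "(u, y) \<in> generator T" for u y
    proof (rule Lim_in_closed_set[OF K(2) _ _ euler_tendsto[OF u(2) t]])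
      show "\<forall>\<^sub>F n in sequentially. (E (t / real n) ^^ n) u \<in> K"
        using small[OF t]
      proof eventually_elim
        case (elim n)
        have "(E (t / real n) ^^ k) u \<in> K" for k
          by (induction k) (use elim E u in auto)
        then show ?case .
      qed
    qed simp
    \<comment> \<open>Euler convergence is established only on the domain. A general
      \<open>x\<close> in \<open>K\<close> is approximated by \<open>E (1 / n) x\<close>, which is
      in the domain and still in \<open>K\<close>.\<close>
    have "(\<lambda>n. T t (E (1 / real n) x)) \<longlonglongrightarrow> T t x"
      using \<open>t \<ge> 0\<close>
      by (intro bounded_linear.tendsto[OF bounded_linear_T] filterlim_compose[OF E_tendsto]
          filterlim_const_over_n_at_right) auto
    moreover have "\<forall>\<^sub>F n in sequentially. T t (E (1 / real n) x) \<in> K"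
      using small[of 1, OF zero_less_one]
    proof eventually_elim
      case (elim n)
      have n: "real n > 0" using elim by (auto simp: zero_less_divide_iff)
      have "E (1 / real n) x = J (real n) (real n *\<^sub>R x)"
        using n by (simp add: E_def linear_scale[OF bounded_linear.linear[OF bounded_linear_J]])
      then have "(E (1 / real n) x, real n *\<^sub>R E (1 / real n) x - real n *\<^sub>R x) \<in> generator T"
        using J_generator[OF n] by simp
      then show ?case
        using elim E x by (intro gen) auto
    qed
    ultimately show ?thesis
      by (rule Lim_in_closed_set[OF K(2) _ sequentially_bot, rotated])
  qed (use x in \<open>simp add: T_0\<close>)
qed

section \<open>Invariance under the functional calculus, and the Krylov subspace\<close>

lemma minus_op_generator_invariant:
  assumes K: "subspace K" "closed K" "\<And>t. t \<ge> 0 \<Longrightarrow> T t ` K \<subseteq> K"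
    and "(x, y) \<in> minus_op c (generator T) ^^ n" "x \<in> K"
  shows "y \<in> K"
  using assms(4)
proof (induction n arbitrary: y)
  case 0
  then show ?case using assms by simp
next
  case (Suc n)
  then obtain u z where u: "u \<in> K" "(u, z) \<in> generator T" and y: "y = c *\<^sub>R u - z"
    by (auto simp: minus_op_def)
  have "z \<in> K"
  proof (rule Lim_in_closed_set[OF K(2)])
    show "((\<lambda>h. (T h u - u) /\<^sub>R h) \<longlongrightarrow> z) (at_right 0)"
      using u by (simp add: generator_def)
    show "\<forall>\<^sub>F h in at_right 0. (T h u - u) /\<^sub>R h \<in> K"
      unfolding eventually_at_right_field using u(1) K(3)[THEN subsetD, OF _ imageI]
      by (intro exI[of _ 1]) (auto intro!: subspace_scale[OF K(1)] subspace_diff[OF K(1)])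
  qed simp
  then show ?case
    unfolding y by (intro subspace_diff[OF K(1)] subspace_scale[OF K(1)] u)
qed

text \<open>A complex subspace is required here because the transform \<open>g\<close> takes complex
  values; the integral and the powers of \<open>1 - A\<close> use only its real structure.\<close>

lemma calc_invariant:
  assumes K: "complex_vector.subspace K" "closed K" "\<And>t. t \<ge> 0 \<Longrightarrow> T t ` K \<subseteq> K"
    and "(x, y) \<in> calc T f" "x \<in> K"
  shows "y \<in> K"
proof -
  note sub = complex_subspace_imp_subspace[OF K(1)]
  obtain n g z where z: "((\<lambda>s. g s *\<^sub>C T s x) has_integral z) {0..}"
    and y: "(z, y) \<in> minus_op 1 (generator T) ^^ n"
    using assms(4) by (auto simp: calc_def calc_tilde_def)
  have "z \<in> K"
    using K(3) \<open>x \<in> K\<close>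
    by (intro has_integral_in_closed_subspace[OF sub K(2) _ z] complex_vector.subspace_scale[OF K(1)]) auto
  then show ?thesis
    using minus_op_generator_invariant[OF sub K(2,3) y] by blast
qed

text \<open>The resolvent sends the \<open>k\<close>-th spanning vector to the next one. Complex
  linearity extends this to the span, and continuity to the closure.\<close>

lemma krylov_invariant:
  assumes "g > 0"
  shows "J g ` closure (krylov (resolvent_op g (generator T)) v)
           \<subseteq> closure (krylov (resolvent_op g (generator T)) v)"
proof -
  let ?R = "resolvent_op g (generator T)"
  interpret J: bounded_linear "J g"
    using assms by (rule bounded_linear_J)
  have "J g w \<in> krylov ?R v" if "w \<in> krylov ?R v" for w
    using that unfolding krylov_def
  proof (induction rule: complex_vector.span_induct_alt)
    case base
    then show ?case by (simp add: J.zero complex_vector.span_zero)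
  next
    case (step c w u)
    then obtain k where "(v, w) \<in> ?R ^^ k" by auto
    then have "(v, J g w) \<in> ?R ^^ Suc k"
      by (auto simp: resolvent_op_generator[OF assms])
    then have "J g w \<in> complex_vector.span {w. \<exists>k. (v, w) \<in> ?R ^^ k}"
      by (intro complex_vector.span_base) blast
    with step show ?case
      by (simp add: J.add J_scaleC[OF assms] complex_vector.span_add complex_vector.span_scale)
  qed
  then have "J g ` krylov ?R v \<subseteq> closure (krylov ?R v)"
    using closure_subset by blast
  then show ?thesis
    by (intro image_closure_subset linear_continuous_on bounded_linear_J assms closed_closure)
qed

end

theorem theorem4p2:
  fixes T :: "real \<Rightarrow> 'a::complex_banach \<Rightarrow> 'a"
    and A :: "('a \<times> 'a) set"
    and N \<gamma> :: real
  assumes "c0_semigroup T"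
    and "A = generator T"
    and "\<And>t. t \<ge> 0 \<Longrightarrow> onorm (T t) \<le> N"
    and "\<gamma> > 0"
  shows "\<forall>v. \<forall>f\<in>M_calc T. apply_op (calc T f) v \<in> closure (krylov (resolvent_op \<gamma> A) v)"
proof (intro allI ballI)
  fix v f assume f: "f \<in> M_calc T"
  interpret bounded_c0_semigroup T N
    using assms by unfold_locales
  let ?K = "closure (krylov (resolvent_op \<gamma> A) v)"
  have K: "complex_vector.subspace ?K"
    by (auto simp: krylov_def intro!: complex_subspace_closure)
  have T: "T t ` ?K \<subseteq> ?K" if "t \<ge> 0" for t
    using krylov_invariant[OF \<open>\<gamma> > 0\<close>] that \<open>\<gamma> > 0\<close> unfolding \<open>A = generator T\<close>
    by (intro T_invariant[of _ \<gamma>] complex_subspace_imp_subspace K[unfolded \<open>A = generator T\<close>]) auto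
  have "(v, v) \<in> resolvent_op \<gamma> A ^^ 0" by simp
  then have "v \<in> krylov (resolvent_op \<gamma> A) v"
    unfolding krylov_def by (intro complex_vector.span_base) blast
  then have v: "v \<in> ?K"
    using closure_subset by blast
  obtain B where B: "calc T f = {(x, B x) | x. True}"
    using f by (auto simp: M_calc_def)
  then have "(v, B v) \<in> calc T f" by simp
  from calc_invariant[OF K closed_closure T this v] have "B v \<in> ?K" .
  \<comment> \<open>Membership in \<open>M_calc T\<close> makes \<open>calc T f\<close> the graph of
    \<open>B\<close>, so the description in \<open>apply_op\<close> has exactly one
    solution.\<close>
  moreover have "apply_op (calc T f) v = B v"
    by (simp add: apply_op_def B)
  ultimately show "apply_op (calc T f) v \<in> ?K" by simp
qed

end
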